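(* Let $X=(X_n)_{n\in\mathbb{Z}}$ be a stationary and ergodic sequence of $\mathbb{Z}$-valued random variables with $\mathbb{E}[|X_0|]<\infty$, and let $\mathbb{Z}^R_X$ be the record graph of $(\mathbb{Z},X)$. 1. If $\mathbb{E}[X_0]<0$, then a.s. every connected component of $\mathbb{Z}^R_X$ is of class $\mathcal{F}/\mathcal{F}$. 2. If $\mathbb{E}[X_0]>0$, then a.s. $\mathbb{Z}^R_X$ is connected and of class $\mathcal{I}/\mathcal{F}$. 3. If $\mathbb{E}[X_0]=0$, then a.s. $\mathbb{Z}^R_X$ is connected, and it is either of class $\mathcal{I}/\mathcal{F}$ or of class $\mathcal{I}/\mathcal{I}$.
   Context: **Record graph.** For an integer-valued sequence $x$ the record map is $R_x(i)=\inf\{j>i:\sum_{l=i}^{j-1}x_l\ge 0\}$ if the infimum exists and $R_x(i)=i$ otherwise. The record graph $\mathbb{Z}^R_x$ is the directed graph on $\mathbb{Z}$ with edges $(i,R_x(i))$ for all $i$ with $R_x(i)\ne i$; connectedness refers to the underlying undirected graph. **Classes.** The foil of $i\in\mathbb{Z}$ is $\{j: R_x^n(j)=R_x^n(i)\text{ for some }n\ge0\}$; each foil is contained in a single connected component. A component $C$ is of class $\mathcal{F}/\mathcal{F}$ if $C$ and all its foils are finite; of class $\mathcal{I}/\mathcal{F}$ if $C$ is infinite but all its foils are finite; of class $\mathcal{I}/\mathcal{I}$ if $C$ and all its foils are infinite. *)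

theory Defs
  imports "HOL-Probability.Probability" "Graph_Theory.Digraph_Component"
begin

section \<open>Stationary and ergodic integer-valued sequences\<close>

abbreviation path_space :: "(int \<Rightarrow> int) measure" where
  "path_space \<equiv> \<Pi>\<^sub>M n\<in>UNIV. count_space UNIV"

definition shift :: "(int \<Rightarrow> int) \<Rightarrow> (int \<Rightarrow> int)" where
  "shift x = (\<lambda>n. x (n + 1))"

text \<open>
  In the next two definitions every \<open>X n\<close> is meant to be a random variable on the probability
  space \<open>M\<close>; measurability is not part of the definitions and has to be assumed separately.
\<close>

definition stationary_sequence :: "'a measure \<Rightarrow> (int \<Rightarrow> 'a \<Rightarrow> int) \<Rightarrow> bool" where
  "stationary_sequence M X \<longleftrightarrow>
     (\<forall>k. distr M path_space (\<lambda>\<omega> n. X (n + k) \<omega>) = distr M path_space (\<lambda>\<omega> n. X n \<omega>))"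

definition ergodic_sequence :: "'a measure \<Rightarrow> (int \<Rightarrow> 'a \<Rightarrow> int) \<Rightarrow> bool" where
  "ergodic_sequence M X \<longleftrightarrow>
     (\<forall>A \<in> sets path_space. shift -` A = A \<longrightarrow>
        measure (distr M path_space (\<lambda>\<omega> n. X n \<omega>)) A \<in> {0, 1})"

section \<open>The record graph\<close>

text \<open>
  The set below is bounded from below by \<open>i\<close>, so its infimum in the integers exists iff it is
  nonempty, and it is then the minimum.
\<close>

definition record_map :: "(int \<Rightarrow> int) \<Rightarrow> int \<Rightarrow> int" where
  "record_map x i =
     (let S = {j. j > i \<and> (\<Sum>l = i..j - 1. x l) \<ge> 0} in if S \<noteq> {} then Inf S else i)"

definition record_graph :: "(int \<Rightarrow> int) \<Rightarrow> int pair_pre_digraph" where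
  "record_graph x =
     \<lparr> pverts = UNIV, parcs = {(i, record_map x i) | i. record_map x i \<noteq> i} \<rparr>"

text \<open>
  Connected components of the underlying undirected graph, as vertex sets: the strongly connected
  components of the symmetrised digraph.
\<close>

definition components_of_graph :: "int pair_pre_digraph \<Rightarrow> int set set" where
  "components_of_graph G = pre_digraph.sccs_verts (with_proj (mk_symmetric (with_proj G)))"

definition foil :: "(int \<Rightarrow> int) \<Rightarrow> int \<Rightarrow> int set" where
  "foil x i = {j. \<exists>n. (record_map x ^^ n) j = (record_map x ^^ n) i}"

text \<open>
  The classes of a component \<open>C\<close>, given by its vertex set. Every foil lies in a single component,
  so the foils of \<open>C\<close> are the sets \<open>foil x i\<close> with \<open>i \<in> C\<close>.
\<close>

definition class_FF :: "(int \<Rightarrow> int) \<Rightarrow> int set \<Rightarrow> bool" where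
  "class_FF x C \<longleftrightarrow> finite C \<and> (\<forall>i\<in>C. finite (foil x i))"

definition class_IF :: "(int \<Rightarrow> int) \<Rightarrow> int set \<Rightarrow> bool" where
  "class_IF x C \<longleftrightarrow> infinite C \<and> (\<forall>i\<in>C. finite (foil x i))"

definition class_II :: "(int \<Rightarrow> int) \<Rightarrow> int set \<Rightarrow> bool" where
  "class_II x C \<longleftrightarrow> infinite C \<and> (\<forall>i\<in>C. infinite (foil x i))"

end

theory Submission
  imports Defs
begin

text \<open>
  Record edges are nested, so if every integer has a record, any two orbits meet and the graph is
  connected. By Borel--Cantelli, a partial map on the integers that is a shift-covariant function of
  a stationary sequence almost surely has finite fibres. Applied to the record map and to the map
  \<open>foil_root\<close>, this shows that a foil and its successor are either both finite or both infinite and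
  that foils bounded below are finite.

  Everything else follows from the maximal ergodic theorem. If the mean is negative, then
  integers without a record have positive probability, hence by ergodicity are unbounded in both
  directions, and they cut the graph into finite pieces. If the mean is nonnegative, almost surely
  every integer has a record. If the mean is positive, points at which the walk is strictly higher
  than at all earlier times have positive probability; every orbit passes through all such
  points to its right, so every foil is bounded below.
\<close>

section \<open>Combinatorics of the record map\<close>

definition walk :: "(int \<Rightarrow> int) \<Rightarrow> int \<Rightarrow> int \<Rightarrow> int" where
  "walk x i j = (\<Sum>l = i..j - 1. x l)"

lemma walk_concat:
  assumes "i \<le> j" "j \<le> k"
  shows "walk x i k = walk x i j + walk x j k"
proof -
  have "{i..k - 1} = {i..j - 1} \<union> {j..k - 1}" using assms by auto
  then show ?thesis
    unfolding walk_def by (simp add: sum.union_disjoint)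
qed

lemma record_map_eq_iff:
  "record_map x i = j \<longleftrightarrow>
     i < j \<and> 0 \<le> walk x i j \<and> (\<forall>l. i < l \<and> l < j \<longrightarrow> walk x i l < 0) \<or>
     j = i \<and> (\<forall>l>i. walk x i l < 0)"
proof (cases "\<exists>m>i. 0 \<le> walk x i m")
  case True
  define S where "S = {m. i < m \<and> 0 \<le> walk x i m}"
  obtain m where "m \<in> S" and le: "\<And>k. k \<in> S \<Longrightarrow> nat (m - i) \<le> nat (k - i)"
    using True ex_has_least_nat[of "\<lambda>m. m \<in> S" _ "\<lambda>m. nat (m - i)"] by (auto simp: S_def)
  then have min: "m \<le> k" if "k \<in> S" for k
    using le[OF that] that \<open>m \<in> S\<close> by (auto simp: S_def nat_le_eq_zle)
  have "Inf S = m"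
    using \<open>m \<in> S\<close> min by (intro cInf_eq_minimum) auto
  then have "record_map x i = m"
    using \<open>m \<in> S\<close> by (auto simp: record_map_def S_def walk_def Let_def)
  moreover have "j = m \<longleftrightarrow> i < j \<and> 0 \<le> walk x i j \<and> (\<forall>l. i < l \<and> l < j \<longrightarrow> walk x i l < 0)"
    using \<open>m \<in> S\<close> min unfolding S_def by (smt (verit) mem_Collect_eq)
  ultimately show ?thesis
    using True by (auto simp: not_less)
next
  case False
  then have "record_map x i = i"
    by (auto simp: record_map_def walk_def Let_def)
  with False show ?thesis by (auto simp: not_le)
qed

lemma record_map_ge: "i \<le> record_map x i"
  using record_map_eq_iff[of x i "record_map x i"] by linarith

lemma record_map_fixed_iff: "record_map x i = i \<longleftrightarrow> (\<forall>l>i. walk x i l < 0)"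
  by (auto simp: record_map_eq_iff)

lemma record_map_le:
  assumes "i < j" "0 \<le> walk x i j"
  shows "i < record_map x i" "record_map x i \<le> j"
  using assms record_map_eq_iff[of x i "record_map x i"] by fastforce+

lemma record_map_nested:
  assumes "i < j" "j < record_map x i"
  shows "j < record_map x j" "record_map x j \<le> record_map x i"
proof -
  have "walk x i j < 0" "0 \<le> walk x i (record_map x i)"
    using assms record_map_eq_iff[of x i "record_map x i"] by auto
  then have "0 \<le> walk x j (record_map x i)"
    using walk_concat[of i j "record_map x i" x] assms by simp
  then show "j < record_map x j" "record_map x j \<le> record_map x i"
    using record_map_le[OF assms(2)] by auto
qed

lemma record_map_le_fixed:
  assumes "record_map x k = k" "i \<le> k"
  shows "record_map x i \<le> k"
  using record_map_nested[of i k x] assms by (cases "i = k") force+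

definition total_record :: "(int \<Rightarrow> int) \<Rightarrow> bool" where
  "total_record x \<longleftrightarrow> (\<forall>i. i < record_map x i)"

lemma record_map_iterate_reaches:
  assumes "i \<le> k" "\<And>l. i \<le> l \<Longrightarrow> l < k \<Longrightarrow> l < record_map x l \<and> record_map x l \<le> k"
  shows "\<exists>n. (record_map x ^^ n) i = k"
  using assms
proof (induction "nat (k - i)" arbitrary: i rule: less_induct)
  case less
  show ?case
  proof (cases "i = k")
    case True
    then have "(record_map x ^^ 0) i = k" by simp
    then show ?thesis by blast
  next
    case False
    then have step: "i < record_map x i" "record_map x i \<le> k"
      using less.prems by auto
    then have "\<exists>n. (record_map x ^^ n) (record_map x i) = k"
      using less.prems by (intro less.hyps) auto
    then obtain n where "(record_map x ^^ Suc n) i = k"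
      by (auto simp: funpow_swap1)
    then show ?thesis by blast
  qed
qed

lemma total_record_orbits_meet:
  assumes "total_record x"
  shows "\<exists>m n. (record_map x ^^ m) i = (record_map x ^^ n) j"
proof -
  have meet: "\<exists>m n. (record_map x ^^ m) i = (record_map x ^^ n) j" if "i \<le> j" for i j
    using that
  proof (induction "nat (j - i)" arbitrary: i rule: less_induct)
    case less
    have step: "i < record_map x i" using assms by (simp add: total_record_def)
    show ?case
    proof (cases "record_map x i \<le> j")
      case True
      then obtain m n where "(record_map x ^^ m) (record_map x i) = (record_map x ^^ n) j"
        using less.hyps[of "record_map x i"] step by auto
      then have "(record_map x ^^ Suc m) i = (record_map x ^^ n) j"
        by (simp add: funpow_swap1)
      then show ?thesis by blast
    next
      case False
      show ?thesis
      proof (cases "i = j")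
        case False
        then have "\<exists>n. (record_map x ^^ n) j = record_map x i"
          using \<open>\<not> record_map x i \<le> j\<close> less.prems record_map_nested[of i _ x]
          by (intro record_map_iterate_reaches) auto
        then obtain n where "(record_map x ^^ n) j = record_map x i" by blast
        then have "(record_map x ^^ 1) i = (record_map x ^^ n) j" by simp
        then show ?thesis by blast
      qed auto
    qed
  qed
  show ?thesis
    using meet[of i j] meet[of j i] by (metis linear)
qed

lemma foil_eqI:
  assumes "j \<in> foil x i"
  shows "foil x j = foil x i"
proof -
  have later: "(record_map x ^^ (n + m)) a = (record_map x ^^ (n + m)) b"
    if "(record_map x ^^ n) a = (record_map x ^^ n) b" for n m a b
    using that by (simp add: funpow_add add.commute[of n m])
  obtain n where n: "(record_map x ^^ n) j = (record_map x ^^ n) i"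
    using assms by (auto simp: foil_def)
  show ?thesis
    unfolding foil_def using later n by (smt (verit) Collect_cong add.commute)
qed

lemma record_map_mem_foil_iff: "record_map x j \<in> foil x (record_map x i) \<longleftrightarrow> j \<in> foil x i"
proof
  assume "record_map x j \<in> foil x (record_map x i)"
  then obtain n where "(record_map x ^^ Suc n) j = (record_map x ^^ Suc n) i"
    by (auto simp: foil_def funpow_swap1)
  then show "j \<in> foil x i" unfolding foil_def by blast
next
  assume "j \<in> foil x i"
  then obtain n where "(record_map x ^^ n) j = (record_map x ^^ n) i"
    by (auto simp: foil_def)
  then have "(record_map x ^^ n) (record_map x j) = (record_map x ^^ n) (record_map x i)"
    by (simp add: funpow_swap1[symmetric])
  then show "record_map x j \<in> foil x (record_map x i)" by (auto simp: foil_def)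
qed

lemma self_mem_foil: "i \<in> foil x i"
  by (simp add: foil_def)

lemma bdd_below_int_imp_least:
  fixes S :: "int set"
  assumes "bdd_below S" "S \<noteq> {}"
  obtains m where "m \<in> S" "\<And>k. k \<in> S \<Longrightarrow> m \<le> k"
proof -
  obtain b where b: "\<And>k. k \<in> S \<Longrightarrow> b \<le> k" using assms(1) by (auto simp: bdd_below_def)
  obtain k where "k \<in> S" using assms(2) by blast
  then obtain m where m: "m \<in> S" "\<forall>k. k \<in> S \<longrightarrow> nat (m - b) \<le> nat (k - b)"
    using ex_has_least_nat[of "\<lambda>m. m \<in> S" k "\<lambda>m. nat (m - b)"] by blast
  show ?thesis
  proof (rule that[OF m(1)])
    fix k assume "k \<in> S"
    then have "nat (m - b) \<le> nat (k - b)" "b \<le> k" using m(2) b by auto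
    then show "m \<le> k" by linarith
  qed
qed

text \<open>
  The integer below depends on \<open>i\<close> only through the foil of \<open>i\<close>, so a foil that has one is
  contained in a fibre of the partial map \<open>foil_root x\<close>. Foils bounded below (in
  particular finite ones) provide such an integer for the next foil, that of \<open>record_map x i\<close>.
\<close>

definition foil_root :: "(int \<Rightarrow> int) \<Rightarrow> int \<Rightarrow> int \<Rightarrow> bool" where
  "foil_root x i j \<longleftrightarrow>
     record_map x j \<in> foil x i \<and> (\<forall>k. record_map x k \<in> foil x i \<longrightarrow> j \<le> k)"

definition finite_fibres :: "(int \<Rightarrow> int) \<Rightarrow> bool" where
  "finite_fibres x \<longleftrightarrow>
     (\<forall>j. finite {i. record_map x i = j}) \<and> (\<forall>j. finite {i. foil_root x i j})"

lemma finite_foil_record_map: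
  assumes "finite_fibres x" "bdd_below (foil x i)"
  shows "finite (foil x (record_map x i))"
proof -
  obtain j where j: "j \<in> foil x i" "\<And>k. k \<in> foil x i \<Longrightarrow> j \<le> k"
    using bdd_below_int_imp_least[OF assms(2)] self_mem_foil[of i x] by blast
  have "foil_root x l j" if "l \<in> foil x (record_map x i)" for l
    using j unfolding foil_root_def foil_eqI[OF that] record_map_mem_foil_iff by auto
  then have "foil x (record_map x i) \<subseteq> {l. foil_root x l j}" by auto
  moreover have "finite {l. foil_root x l j}"
    using assms(1) by (simp add: finite_fibres_def)
  ultimately show ?thesis by (rule finite_subset)
qed

lemma finite_foil_of_record_map:
  assumes "finite_fibres x" "finite (foil x (record_map x i))"
  shows "finite (foil x i)"
proof -
  have "foil x i \<subseteq> (\<Union>j\<in>foil x (record_map x i). {i. record_map x i = j})"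
    by (auto simp: record_map_mem_foil_iff)
  moreover have "finite (\<Union>j\<in>foil x (record_map x i). {i. record_map x i = j})"
    using assms unfolding finite_fibres_def by (intro finite_UN_I) auto
  ultimately show ?thesis by (rule finite_subset)
qed

lemma finite_foil_if_bdd_below:
  assumes "finite_fibres x" "bdd_below (foil x i)"
  shows "finite (foil x i)"
  using finite_foil_of_record_map[OF assms(1) finite_foil_record_map[OF assms]] .

lemma finite_foil_iff:
  assumes "finite_fibres x" "total_record x"
  shows "finite (foil x i) \<longleftrightarrow> finite (foil x j)"
proof -
  have step: "finite (foil x (record_map x i)) \<longleftrightarrow> finite (foil x i)" for i
    using finite_foil_record_map[OF assms(1) bdd_below_finite, of i]
      finite_foil_of_record_map[OF assms(1), of i] by (rule iffI[rotated])
  have "finite (foil x ((record_map x ^^ n) i)) \<longleftrightarrow> finite (foil x i)" for n i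
    by (induction n) (auto simp: step)
  then show ?thesis
    using total_record_orbits_meet[OF assms(2), of i j] by (metis (full_types))
qed

definition spine_point :: "(int \<Rightarrow> int) \<Rightarrow> int \<Rightarrow> bool" where
  "spine_point x k \<longleftrightarrow> (\<forall>l<k. 0 < walk x l k)"

lemma record_map_iterate_reaches_spine:
  assumes "spine_point x k" "i \<le> k"
  shows "\<exists>n. (record_map x ^^ n) i = k"
  using assms record_map_le[of _ k x] unfolding spine_point_def
  by (intro record_map_iterate_reaches) (auto simp: less_imp_le)

lemma spine_descendants_far:
  assumes "\<And>m. \<exists>k\<le>m. spine_point x k" "spine_point x k"
  shows "\<exists>q. \<forall>j\<le>q. \<exists>c\<ge>n. (record_map x ^^ c) j = k"
proof (induction n)
  case 0
  show ?case using record_map_iterate_reaches_spine[OF assms(2)] by blast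
next
  case (Suc n)
  then obtain q where q: "\<And>j. j \<le> q \<Longrightarrow> \<exists>c\<ge>n. (record_map x ^^ c) j = k" by blast
  obtain p where p: "p \<le> q" "spine_point x p" using assms(1) by blast
  have "\<exists>c\<ge>Suc n. (record_map x ^^ c) j = k" if "j \<le> p - 1" for j
  proof -
    obtain d where d: "(record_map x ^^ d) j = p"
      using record_map_iterate_reaches_spine[OF p(2), of j] \<open>j \<le> p - 1\<close> by auto
    have "d \<noteq> 0" using d that by (cases d) auto
    obtain c where c: "n \<le> c" "(record_map x ^^ c) p = k" using q[OF p(1)] by blast
    have "(record_map x ^^ (c + d)) j = k" using c d by (simp add: funpow_add)
    then show ?thesis using \<open>d \<noteq> 0\<close> c(1) by (intro exI[of _ "c + d"]) auto
  qed
  then show ?case by blast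
qed

lemma total_record_iterate_inject:
  assumes "total_record x"
  shows "(record_map x ^^ m) i = (record_map x ^^ n) i \<longleftrightarrow> m = n"
proof -
  have "strict_mono (\<lambda>n. (record_map x ^^ n) i)"
    using assms by (intro strict_monoI_Suc) (simp add: total_record_def)
  then show ?thesis by (rule strict_mono_eq)
qed

lemma spine_imp_bdd_below_foil:
  assumes "total_record x" "\<And>m. \<exists>k\<le>m. spine_point x k"
  shows "bdd_below (foil x i)"
proof -
  obtain k where k: "spine_point x k" using assms(2) by blast
  obtain a b where ab: "(record_map x ^^ a) k = (record_map x ^^ b) i"
    using total_record_orbits_meet[OF assms(1)] by blast
  obtain q where q: "\<And>j. j \<le> q \<Longrightarrow> \<exists>c\<ge>Suc b. (record_map x ^^ c) j = k"
    using spine_descendants_far[OF assms(2) k] by blast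
  have "q \<le> j" if j: "j \<in> foil x i" for j
  proof (rule ccontr)
    assume "\<not> q \<le> j"
    then obtain c where c: "Suc b \<le> c" "(record_map x ^^ c) j = k" using q[of j] by auto
    obtain m where m: "(record_map x ^^ m) j = (record_map x ^^ m) i"
      using j by (auto simp: foil_def)
    have "(record_map x ^^ (b + m)) j = (record_map x ^^ (b + m)) i"
      using m by (simp add: funpow_add)
    also have "\<dots> = (record_map x ^^ (m + b)) i" by (simp only: add.commute)
    also have "\<dots> = (record_map x ^^ (m + a + c)) j"
      using ab c(2) by (simp add: funpow_add)
    finally have "b + m = m + a + c"
      using total_record_iterate_inject[OF assms(1)] by blast
    then show False using c(1) by simp
  qed
  then show ?thesis by (auto simp: bdd_below_def)
qed

section \<open>Components of the record graph\<close>

abbreviation sym_record_graph :: "(int \<Rightarrow> int) \<Rightarrow> int pair_pre_digraph" where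
  "sym_record_graph x \<equiv> mk_symmetric (with_proj (record_graph x))"

lemma parcs_sym_record_graph:
  "parcs (sym_record_graph x) =
     {(i, j). i \<noteq> j \<and> (record_map x i = j \<or> record_map x j = i)}"
  by (simp add: parcs_mk_symmetric record_graph_def set_eq_iff) metis

lemma pverts_record_graph: "pverts (record_graph x) = UNIV"
  by (simp add: record_graph_def)

lemma reachable_sym_record_graph_iff:
  "reachable (with_proj (sym_record_graph x)) i j \<longleftrightarrow>
     (i, j) \<in> {(i, j). record_map x i = j \<or> record_map x j = i}\<^sup>*"
  (is "_ \<longleftrightarrow> _ \<in> ?E\<^sup>*")
proof -
  let ?P = "parcs (sym_record_graph x)"
  have "?P \<subseteq> ?E" "?E \<subseteq> ?P \<union> Id"
    by (auto simp: parcs_sym_record_graph)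
  then have "?E\<^sup>* = ?P\<^sup>*"
    by (intro rtrancl_subset) auto
  moreover have "(i, j) \<in> rtrancl_on UNIV ?P \<longleftrightarrow> (i, j) \<in> ?P\<^sup>*"
    by (auto intro: rtrancl_on_rtranclI rtrancl_consistent_rtrancl_on)
  ultimately show ?thesis
    by (simp add: reachable_def pverts_record_graph)
qed

lemma reachable_iterate:
  "(i, (record_map x ^^ n) i) \<in> {(i, j). record_map x i = j \<or> record_map x j = i}\<^sup>*"
  "((record_map x ^^ n) i, i) \<in> {(i, j). record_map x i = j \<or> record_map x j = i}\<^sup>*"
  (is "_ \<in> ?E\<^sup>*")
proof (induction n)
  case (Suc n)
  have "((record_map x ^^ n) i, (record_map x ^^ Suc n) i) \<in> ?E"
    "((record_map x ^^ Suc n) i, (record_map x ^^ n) i) \<in> ?E" by auto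
  {
    case 1
    show ?case using Suc(1) \<open>((record_map x ^^ n) i, (record_map x ^^ Suc n) i) \<in> ?E\<close>
      by (rule rtrancl_into_rtrancl)
  next
    case 2
    show ?case using \<open>((record_map x ^^ Suc n) i, (record_map x ^^ n) i) \<in> ?E\<close> Suc(2)
      by (rule converse_rtrancl_into_rtrancl)
  }
qed auto

lemma total_record_connected:
  assumes "total_record x"
  shows "Digraph_Component.connected (with_proj (record_graph x))"
proof -
  have "reachable (with_proj (sym_record_graph x)) i j" for i j
  proof -
    obtain m n where "(record_map x ^^ m) i = (record_map x ^^ n) j"
      using total_record_orbits_meet[OF assms] by blast
    then have "(i, (record_map x ^^ n) j) \<in> {(i, j). record_map x i = j \<or> record_map x j = i}\<^sup>*"
      using reachable_iterate(1)[where n = m and i = i and x = x] by simp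
    then show ?thesis
      unfolding reachable_sym_record_graph_iff using reachable_iterate(2) by (rule rtrancl_trans)
  qed
  then show ?thesis
    by (simp add: Digraph_Component.connected_def strongly_connected_def pverts_record_graph)
qed

lemma fixed_unbounded_imp_class_FF:
  assumes "\<And>m. \<exists>k\<le>m. record_map x k = k" "\<And>m. \<exists>k\<ge>m. record_map x k = k"
    and C: "C \<in> components_of_graph (record_graph x)"
  shows "class_FF x C"
proof -
  have invariant: "\<exists>I. finite I \<and> i \<in> I \<and> (\<forall>j. record_map x j \<in> I \<longleftrightarrow> j \<in> I)" for i
  proof -
    obtain a b where a: "a \<le> i - 1" "record_map x a = a" and b: "i \<le> b" "record_map x b = b"
      using assms(1,2) by meson
    have "record_map x j \<in> {a<..b} \<longleftrightarrow> j \<in> {a<..b}" for j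
      using record_map_le_fixed[OF a(2), of j] record_map_le_fixed[OF b(2), of j]
        record_map_ge[of j x] unfolding greaterThanAtMost_iff by (smt (verit))
    then show ?thesis using a(1) b(1) by (intro exI[of _ "{a<..b}"]) auto
  qed
  have "C \<noteq> {}" and reach: "\<And>i j. i \<in> C \<Longrightarrow> j \<in> C \<Longrightarrow>
      reachable (with_proj (sym_record_graph x)) i j"
    using C unfolding components_of_graph_def pre_digraph.sccs_verts_def by blast+
  have "finite C"
  proof -
    obtain i where i: "i \<in> C" using \<open>C \<noteq> {}\<close> by blast
    obtain I where I: "finite I" "i \<in> I" "\<And>j. record_map x j \<in> I \<longleftrightarrow> j \<in> I"
      using invariant by blast
    have "j \<in> I" if "j \<in> C" for j
    proof -
      have "(i, j) \<in> {(i, j). record_map x i = j \<or> record_map x j = i}\<^sup>*"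
        using reach[OF i that] unfolding reachable_sym_record_graph_iff .
      then show ?thesis
      proof (induction rule: rtrancl_induct)
        case base
        show ?case by (rule I(2))
      next
        case (step k l)
        then show ?case using I(3)[of k] I(3)[of l] by auto
      qed
    qed
    then show ?thesis using I(1) by (meson finite_subset subsetI)
  qed
  moreover have "finite (foil x i)" for i
  proof -
    obtain I where I: "finite I" "i \<in> I" "\<And>j. record_map x j \<in> I \<longleftrightarrow> j \<in> I"
      using invariant by blast
    have iter: "(record_map x ^^ n) j \<in> I \<longleftrightarrow> j \<in> I" for n j
      by (induction n) (auto simp: I(3))
    have "foil x i \<subseteq> I"
    proof
      fix j assume "j \<in> foil x i"
      then obtain n where "(record_map x ^^ n) j = (record_map x ^^ n) i"
        by (auto simp: foil_def)
      then show "j \<in> I" using iter[of n i] iter[of n j] I(2) by simp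
    qed
    then show ?thesis using I(1) by (rule finite_subset)
  qed
  ultimately show ?thesis by (simp add: class_FF_def)
qed

lemma total_record_class_cases:
  assumes "total_record x" "finite_fibres x"
  shows "class_IF x UNIV \<or> class_II x UNIV"
  using finite_foil_iff[OF assms(2,1)] by (auto simp: class_IF_def class_II_def infinite_UNIV_int)

lemma spine_imp_class_IF:
  assumes "total_record x" "finite_fibres x" "\<And>m. \<exists>k\<le>m. spine_point x k"
  shows "class_IF x UNIV"
  using spine_imp_bdd_below_foil[OF assms(1,3)] finite_foil_if_bdd_below[OF assms(2)]
  by (auto simp: class_IF_def infinite_UNIV_int)

section \<open>The maximal ergodic theorem\<close>

primrec max_sum :: "('a \<Rightarrow> real) \<Rightarrow> ('a \<Rightarrow> 'a) \<Rightarrow> nat \<Rightarrow> 'a \<Rightarrow> real" where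
  "max_sum g T 0 x = 0"
| "max_sum g T (Suc n) x = max 0 (g x + max_sum g T n (T x))"

lemma max_sum_nonneg: "0 \<le> max_sum g T n x"
  by (cases n) auto

lemma max_sum_le_Suc: "max_sum g T n x \<le> max_sum g T (Suc n) x"
proof (induction n arbitrary: x)
  case (Suc n)
  show ?case using Suc[of "T x"] by simp
qed simp

lemma max_sum_mono: "m \<le> n \<Longrightarrow> max_sum g T m x \<le> max_sum g T n x"
  using max_sum_le_Suc by (rule lift_Suc_mono_le)

lemma sum_le_max_sum: "(\<Sum>l<n. g ((T ^^ l) x)) \<le> max_sum g T n x"
proof (induction n arbitrary: x)
  case (Suc n)
  have "(\<Sum>l<Suc n. g ((T ^^ l) x)) = g x + (\<Sum>l<n. g ((T ^^ l) (T x)))"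
    by (simp only: sum.lessThan_Suc_shift funpow_Suc_right) simp
  then show ?case using Suc[of "T x"] by simp
qed simp

lemma integrable_compose_invariant:
  fixes f :: "'a \<Rightarrow> real"
  assumes "T \<in> N \<rightarrow>\<^sub>M N" "distr N N T = N" "integrable N f"
  shows "integrable N (\<lambda>x. f (T x))"
  using integrable_distr[OF assms(1), of f] assms(2,3) by simp

lemma integral_compose_invariant:
  fixes f :: "'a \<Rightarrow> real"
  assumes "T \<in> N \<rightarrow>\<^sub>M N" "distr N N T = N" "f \<in> borel_measurable N"
  shows "(\<integral>x. f (T x) \<partial>N) = (\<integral>x. f x \<partial>N)"
  using integral_distr[OF assms(1,3)] assms(2) by simp

lemma integrable_max_sum:
  assumes "T \<in> N \<rightarrow>\<^sub>M N" "distr N N T = N" "integrable N g"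
  shows "integrable N (max_sum g T n)"
proof (induction n)
  case 0
  have "max_sum g T 0 = (\<lambda>_. 0)" by auto
  then show ?case by simp
next
  case (Suc n)
  have "max_sum g T (Suc n) = (\<lambda>x. max 0 (g x + max_sum g T n (T x)))" by auto
  then show ?case
    using integrable_compose_invariant[OF assms(1,2) Suc] assms(3) by simp
qed

text \<open>
  Garsia's argument: on the event \<open>B n\<close> that \<open>0 \<le> g + W n \<circ> T\<close>, where \<open>W n\<close> is the maximal sum,
  \<open>g = W (n + 1) - W n \<circ> T\<close>, so \<open>g\<close> restricted to \<open>B n\<close> dominates \<open>W n - W n \<circ> T\<close>, which has
  integral zero.
\<close>

theorem maximal_ergodic:
  fixes g :: "'a \<Rightarrow> real"
  assumes T: "T \<in> N \<rightarrow>\<^sub>M N" and inv: "distr N N T = N" and g: "integrable N g"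
    and ex: "AE x in N. \<exists>j>0. 0 \<le> (\<Sum>l<j. g ((T ^^ l) x))"
  shows "0 \<le> (\<integral>x. g x \<partial>N)"
proof -
  let ?W = "max_sum g T"
  define h where "h n x = (if 0 \<le> g x + ?W n (T x) then g x else 0)" for n x
  note W = integrable_max_sum[OF T inv g]
  note WT = integrable_compose_invariant[OF T inv W]
  have [measurable]: "g \<in> borel_measurable N" "(\<lambda>x. ?W n (T x)) \<in> borel_measurable N" for n
    using g WT by auto
  have meas: "h n \<in> borel_measurable N" for n
    unfolding h_def by measurable
  have "0 \<le> (\<integral>x. h n x \<partial>N)" for n
  proof -
    have "?W n x - ?W n (T x) \<le> h n x" for x
      using max_sum_le_Suc[of g T n x] max_sum_nonneg[of g T n "T x"]
      by (auto simp: h_def max_def split: if_splits)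
    moreover have "integrable N (h n)"
      using g meas by (rule Bochner_Integration.integrable_bound) (auto simp: h_def)
    ultimately have "(\<integral>x. ?W n x - ?W n (T x) \<partial>N) \<le> (\<integral>x. h n x \<partial>N)"
      using W WT by (intro integral_mono) auto
    moreover have "(\<integral>x. ?W n x - ?W n (T x) \<partial>N) = 0"
      using W WT integral_compose_invariant[OF T inv, of "?W n"] by simp
    ultimately show ?thesis by simp
  qed
  moreover have "(\<lambda>n. \<integral>x. h n x \<partial>N) \<longlonglongrightarrow> (\<integral>x. g x \<partial>N)"
  proof (rule integral_dominated_convergence[where w = "\<lambda>x. \<bar>g x\<bar>"])
    show "AE x in N. (\<lambda>n. h n x) \<longlonglongrightarrow> g x"
      using ex
    proof eventually_elim
      case (elim x)
      then obtain m where m: "0 \<le> (\<Sum>l<Suc m. g ((T ^^ l) x))" by (metis gr0_implies_Suc)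
      have "h n x = g x" if "m \<le> n" for n
      proof -
        have "0 \<le> g x + (\<Sum>l<m. g ((T ^^ l) (T x)))"
          using m by (simp only: sum.lessThan_Suc_shift funpow_Suc_right) simp
        also have "\<dots> \<le> g x + ?W n (T x)"
          using sum_le_max_sum[of g T "T x" m] max_sum_mono[OF that, of g T "T x"] by simp
        finally show ?thesis by (simp add: h_def)
      qed
      then have "\<forall>\<^sub>F n in sequentially. h n x = g x"
        unfolding eventually_sequentially by blast
      then show ?case by (rule tendsto_eventually)
    qed
  qed (use g meas in \<open>auto simp: h_def\<close>)
  ultimately show ?thesis
    by (intro LIMSEQ_le_const[where X = "\<lambda>n. \<integral>x. h n x \<partial>N"]) auto
qed

section \<open>Shifts of the path space\<close>

definition shift_by :: "int \<Rightarrow> (int \<Rightarrow> int) \<Rightarrow> (int \<Rightarrow> int)" where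
  "shift_by k x = (\<lambda>n. x (n + k))"

lemma shift_by_shift_by: "shift_by k (shift_by l x) = shift_by (k + l) x"
  by (simp add: shift_by_def add_ac)

lemma shift_by_0 [simp]: "shift_by 0 x = x"
  by (simp add: shift_by_def)

lemma shift_by_apply: "shift_by k x n = x (n + k)"
  by (simp add: shift_by_def)

lemma shift_eq_shift_by: "shift = shift_by 1"
  by (auto simp: shift_def shift_by_def)

lemma funpow_shift_by: "(shift_by k ^^ n) x = shift_by (k * int n) x"
  by (induction n) (auto simp: shift_by_shift_by algebra_simps)

lemma walk_Suc: "walk x i (i + 1) = x i"
  by (simp add: walk_def)

lemma walk_nat_right: "walk x 0 (int n) = (\<Sum>l<n. x (int l))"
proof (induction n)
  case (Suc n)
  then show ?case
    using walk_concat[of 0 "int n" "int n + 1" x] walk_Suc[of x "int n"] by (simp add: add.commute)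
qed (simp add: walk_def)

lemma walk_nat_left: "walk x (- int n) 0 = (\<Sum>l<n. x (- 1 - int l))"
proof (induction n)
  case (Suc n)
  then show ?case
    using walk_concat[of "- 1 - int n" "- int n" 0 x] walk_Suc[of x "- 1 - int n"]
    by simp
qed (simp add: walk_def)

lemma walk_shift_by: "walk (shift_by k x) i j = walk x (i + k) (j + k)"
  unfolding walk_def
  by (rule sum.reindex_bij_witness[of _ "\<lambda>l. l - k" "\<lambda>l. l + k"]) (auto simp: shift_by_def)

lemma all_add_int_iff:
  fixes k :: int
  shows "(\<forall>l. P (l + k)) \<longleftrightarrow> (\<forall>l. P l)"
  by (metis diff_add_cancel)

lemma record_map_shift_by: "record_map (shift_by k x) i = record_map x (i + k) - k"
proof -
  have "record_map (shift_by k x) i = j \<longleftrightarrow> record_map x (i + k) = j + k" for j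
    unfolding record_map_eq_iff walk_shift_by
    using all_add_int_iff[of "\<lambda>l. i + k < l \<and> l < j + k \<longrightarrow> walk x (i + k) l < 0" k]
      all_add_int_iff[of "\<lambda>l. i + k < l \<longrightarrow> walk x (i + k) l < 0" k]
    by simp
  then show ?thesis by simp
qed

lemma funpow_record_map_shift_by:
  "(record_map (shift_by k x) ^^ n) i = (record_map x ^^ n) (i + k) - k"
  by (induction n) (simp_all add: record_map_shift_by)

lemma foil_shift_by: "j \<in> foil (shift_by k x) i \<longleftrightarrow> j + k \<in> foil x (i + k)"
  by (simp add: foil_def funpow_record_map_shift_by)

lemma foil_root_shift_by: "foil_root (shift_by k x) i j \<longleftrightarrow> foil_root x (i + k) (j + k)"
  unfolding foil_root_def foil_shift_by record_map_shift_by
  using all_add_int_iff[of "\<lambda>l. record_map x l \<in> foil x (i + k) \<longrightarrow> j + k \<le> l" k]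
  by simp

lemma spine_point_shift_by: "spine_point (shift_by k x) i \<longleftrightarrow> spine_point x (i + k)"
  unfolding spine_point_def walk_shift_by
  using all_add_int_iff[of "\<lambda>l. l < i + k \<longrightarrow> 0 < walk x l (i + k)" k] by simp

lemma measurable_shift_by [measurable]: "shift_by k \<in> path_space \<rightarrow>\<^sub>M path_space"
  unfolding shift_by_def by (rule measurable_PiM_single') (auto simp: space_PiM)

lemma measurable_coord [measurable]: "(\<lambda>x. x n) \<in> path_space \<rightarrow>\<^sub>M count_space UNIV"
  by (rule measurable_component_singleton) simp

lemma borel_measurable_coord [measurable]: "(\<lambda>x. real_of_int (x n)) \<in> borel_measurable path_space"
  using measurable_coord by (rule measurable_compose) simp

lemma borel_measurable_walk [measurable]:
  "(\<lambda>x. real_of_int (walk x i j)) \<in> borel_measurable path_space"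
  unfolding walk_def of_int_sum by measurable

lemma pred_walk [measurable]:
  "Measurable.pred path_space (\<lambda>x. 0 \<le> walk x i j)"
  "Measurable.pred path_space (\<lambda>x. walk x i j < 0)"
  "Measurable.pred path_space (\<lambda>x. 0 < walk x i j)"
proof -
  have "Measurable.pred path_space (\<lambda>x. 0 \<le> real_of_int (walk x i j))"
    "Measurable.pred path_space (\<lambda>x. real_of_int (walk x i j) < 0)"
    "Measurable.pred path_space (\<lambda>x. 0 < real_of_int (walk x i j))"
    by measurable
  then show "Measurable.pred path_space (\<lambda>x. 0 \<le> walk x i j)"
    "Measurable.pred path_space (\<lambda>x. walk x i j < 0)"
    "Measurable.pred path_space (\<lambda>x. 0 < walk x i j)"
    by simp_all
qed

lemma measurable_record_map [measurable]:
  "(\<lambda>x. record_map x i) \<in> path_space \<rightarrow>\<^sub>M count_space UNIV"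
proof -
  have "Measurable.pred path_space (\<lambda>x. record_map x i = j)" for j
    unfolding record_map_eq_iff by measurable
  then have "(\<lambda>x. record_map x i) -` {j} \<inter> space path_space \<in> sets path_space" for j
    by (simp add: pred_def vimage_def Collect_conj_eq Int_commute)
  then show ?thesis
    by (subst measurable_count_space_eq2_countable) (auto simp: space_PiM)
qed

lemma measurable_funpow_record_map [measurable]:
  "(\<lambda>x. (record_map x ^^ n) i) \<in> path_space \<rightarrow>\<^sub>M count_space UNIV"
proof (induction n)
  case (Suc n)
  have "(\<lambda>x. record_map x ((record_map x ^^ n) i)) \<in> path_space \<rightarrow>\<^sub>M count_space UNIV"
    by (rule measurable_compose_countable[OF measurable_record_map Suc])
  then show ?case by simp
qed simp

lemma pred_foil_root [measurable]: "Measurable.pred path_space (\<lambda>x. foil_root x i j)"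
proof -
  have "record_map x j \<in> foil x i \<longleftrightarrow> (\<exists>n. (record_map x ^^ Suc n) j = (record_map x ^^ n) i)"
    for x j by (simp add: foil_def funpow_swap1)
  then show ?thesis unfolding foil_root_def by simp
qed

lemma pred_spine_point [measurable]: "Measurable.pred path_space (\<lambda>x. spine_point x k)"
  unfolding spine_point_def by measurable

section \<open>Ergodic stationary laws\<close>

locale ergodic_law = prob_space N for N :: "(int \<Rightarrow> int) measure" +
  assumes sets_eq [measurable_cong]: "sets N = sets path_space"
    and distr_shift_by: "distr N N (shift_by k) = N"
    and zero_one: "A \<in> sets path_space \<Longrightarrow> shift -` A = A \<Longrightarrow> prob A \<in> {0, 1}"
    and integrable_coord_0: "integrable N (\<lambda>x. real_of_int (x 0))"
begin

abbreviation mean :: real where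
  "mean \<equiv> (\<integral>x. real_of_int (x 0) \<partial>N)"

lemma space_eq [simp]: "space N = UNIV"
  using sets_eq_imp_space_eq[OF sets_eq] by (simp add: space_PiM)

lemma measurable_shift_by_law: "shift_by k \<in> N \<rightarrow>\<^sub>M N"
  by measurable

lemma pred_imp_sets:
  assumes "Measurable.pred path_space P"
  shows "{x. P x} \<in> events"
  using assms sets_eq by (simp add: pred_def space_PiM)

lemma prob_shift_by:
  assumes "Measurable.pred path_space P"
  shows "prob {x. P (shift_by k x)} = prob {x. P x}"
  using measure_distr[OF measurable_shift_by_law pred_imp_sets[OF assms], of k]
  by (simp add: distr_shift_by vimage_def)

lemma AE_shift_by:
  assumes "AE x in N. P x"
  shows "AE x in N. \<forall>k. P (shift_by k x)"
proof -
  have "AE x in N. P (shift_by k x)" for k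
  proof (rule AE_distrD[OF measurable_shift_by_law])
    show "AE x in distr N N (shift_by k). P x" unfolding distr_shift_by by (rule assms)
  qed
  then show ?thesis by (simp add: AE_all_countable)
qed

lemma integral_coord:
  "integrable N (\<lambda>x. real_of_int (x n))" "(\<integral>x. real_of_int (x n) \<partial>N) = mean"
  using integrable_compose_invariant[OF measurable_shift_by_law distr_shift_by integrable_coord_0, of n]
    integral_compose_invariant[OF measurable_shift_by_law distr_shift_by, of "\<lambda>x. real_of_int (x 0)" n]
    integrable_coord_0
  by (simp_all add: shift_by_def)

lemma AE_recurrence:
  assumes P [measurable]: "Measurable.pred path_space P" and pos: "0 < prob {x. P x}"
    and s: "s * s = (1 :: int)"
  shows "AE x in N. \<forall>m. \<exists>k\<ge>m. P (shift_by (s * k) x)"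
proof -
  define B where "B m = {x. \<exists>k\<ge>m. P (shift_by (s * k) x)}" for m
  define C where "C = {x. \<forall>m. \<exists>k\<ge>m. P (shift_by (s * k) x)}"
  have [measurable]: "Measurable.pred path_space (\<lambda>x. P (shift_by k x))" for k
    by measurable
  have B: "B m \<in> events" for m
    unfolding B_def by (intro pred_imp_sets) measurable
  have C: "C \<in> events"
    unfolding C_def by (intro pred_imp_sets) measurable
  have same: "prob (B m) = prob (B 0)" for m
  proof -
    have "shift_by (s * m) x \<in> B 0 \<longleftrightarrow> x \<in> B m" for x
    proof
      assume "shift_by (s * m) x \<in> B 0"
      then obtain k where "0 \<le> k" "P (shift_by (s * (k + m)) x)"
        by (auto simp: B_def shift_by_shift_by algebra_simps)
      then show "x \<in> B m" unfolding B_def by (intro CollectI exI[of _ "k + m"]) auto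
    next
      assume "x \<in> B m"
      then obtain k where "m \<le> k" "P (shift_by (s * k) x)" by (auto simp: B_def)
      then show "shift_by (s * m) x \<in> B 0"
        unfolding B_def
        by (intro CollectI exI[of _ "k - m"]) (auto simp: shift_by_shift_by algebra_simps)
    qed
    then show ?thesis
      using prob_shift_by[of "\<lambda>x. x \<in> B 0" "s * m"] B[of 0] sets_eq
      by (simp add: pred_def space_PiM)
  qed
  have "B m \<subseteq> B l" if "l \<le> m" for l m
  proof
    fix x assume "x \<in> B m"
    then obtain k where "m \<le> k" "P (shift_by (s * k) x)" by (auto simp: B_def)
    then show "x \<in> B l" unfolding B_def using that by (intro CollectI exI[of _ k]) auto
  qed
  then have "(\<lambda>n. prob (B (int n))) \<longlonglongrightarrow> prob (\<Inter>n. B (int n))"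
    using B by (intro finite_Lim_measure_decseq) (auto simp: decseq_def)
  then have "prob (\<Inter>n. B (int n)) = prob (B 0)"
    unfolding same[of "int _"] by (simp add: LIMSEQ_const_iff)
  moreover have "(\<Inter>n. B (int n)) = C"
  proof
    show "(\<Inter>n. B (int n)) \<subseteq> C"
    proof
      fix x assume x: "x \<in> (\<Inter>n. B (int n))"
      have "\<exists>k\<ge>m. P (shift_by (s * k) x)" for m
      proof -
        have "x \<in> B (int (nat m))" using x by blast
        then obtain k where "int (nat m) \<le> k" "P (shift_by (s * k) x)"
          unfolding B_def by blast
        moreover from this(1) have "m \<le> k" by linarith
        ultimately show ?thesis by blast
      qed
      then show "x \<in> C" by (simp add: C_def)
    qed
  qed (auto simp: B_def C_def)
  moreover have "prob {x. P x} \<le> prob (B 0)"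
  proof (rule finite_measure_mono[OF _ B])
    show "{x. P x} \<subseteq> B 0" unfolding B_def by (auto intro!: exI[of _ 0])
  qed
  ultimately have "0 < prob C" using pos by simp
  moreover have "shift -` C = C"
  proof -
    have eq: "P (shift_by (s * k) (shift x)) \<longleftrightarrow> P (shift_by (s * (k + s)) x)" for k x
      using s by (simp add: shift_eq_shift_by shift_by_shift_by algebra_simps)
    have "shift x \<in> C \<longleftrightarrow> x \<in> C" for x
    proof
      assume *: "shift x \<in> C"
      have "\<exists>k\<ge>m. P (shift_by (s * k) x)" for m
      proof -
        obtain k where "m - s \<le> k" "P (shift_by (s * (k + s)) x)"
          using * unfolding C_def mem_Collect_eq eq by blast
        then show ?thesis by (intro exI[of _ "k + s"]) auto
      qed
      then show "x \<in> C" by (simp add: C_def)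
    next
      assume *: "x \<in> C"
      have "\<exists>k\<ge>m. P (shift_by (s * (k + s)) x)" for m
      proof -
        obtain k where "m + s \<le> k" "P (shift_by (s * k) x)"
          using * unfolding C_def by auto
        then show ?thesis by (intro exI[of _ "k - s"]) auto
      qed
      then show "shift x \<in> C" by (simp add: C_def eq)
    qed
    then show ?thesis by auto
  qed
  ultimately have "prob C = 1" using zero_one[of C] C sets_eq by auto
  then have "AE x in N. x \<in> C" using C by (simp add: prob_eq_1)
  then show ?thesis by (simp add: C_def)
qed

lemma AE_recurrence_above:
  assumes "Measurable.pred path_space P" "0 < prob {x. P x}"
  shows "AE x in N. \<forall>m. \<exists>k\<ge>m. P (shift_by k x)"
  using AE_recurrence[OF assms, of 1] by simp

lemma AE_recurrence_below:
  assumes "Measurable.pred path_space P" "0 < prob {x. P x}"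
  shows "AE x in N. \<forall>m. \<exists>k\<le>m. P (shift_by k x)"
  using AE_recurrence[OF assms, of "- 1", simplified]
proof eventually_elim
  case (elim x)
  show ?case
  proof
    fix m
    obtain k where "- m \<le> k" "P (shift_by (- k) x)" using elim by blast
    then show "\<exists>k\<le>m. P (shift_by k x)" by (intro exI[of _ "- k"]) auto
  qed
qed

text \<open>
  By stationarity, \<open>i\<close> is sent to \<open>j\<close> with the same probability as \<open>0\<close> is sent to \<open>j - i\<close>; these
  probabilities sum to at most 1, and Borel--Cantelli applies.
\<close>

lemma AE_finite_fibres:
  assumes Q [measurable]: "\<And>i j. Measurable.pred path_space (\<lambda>x. Q x i j)"
    and covariant: "\<And>x k i j. Q (shift_by k x) i j \<longleftrightarrow> Q x (i + k) (j + k)"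
    and unique: "\<And>x i j j'. Q x i j \<Longrightarrow> Q x i j' \<Longrightarrow> j = j'"
  shows "AE x in N. \<forall>j. finite {i. Q x i j}"
proof -
  have "AE x in N. finite {i. Q x i j}" for j
  proof -
    define E where "E n = {x. Q x (int_decode n) j}" for n
    define F where "F n = {x. Q x 0 (j - int_decode n)}" for n
    have E: "E n \<in> events" and F: "F n \<in> events" for n
      unfolding E_def F_def by (auto intro: pred_imp_sets)
    have "prob (E n) = prob (F n)" for n
      using prob_shift_by[of "\<lambda>x. Q x 0 (j - int_decode n)" "int_decode n"] Q
      by (simp add: E_def F_def covariant)
    moreover have "disjoint_family F"
      unfolding disjoint_family_on_def F_def using unique
      by (auto, metis diff_left_imp_eq int_decode_eq)
    then have "summable (\<lambda>n. prob (F n))"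
      using F finite_measure_UNION[of F] by (auto intro: sums_summable)
    ultimately have "summable (\<lambda>n. prob (E n))" by simp
    then have "AE x in N. \<forall>\<^sub>F n in sequentially. x \<in> space N - E n"
      using E by (intro borel_cantelli_AE1) (auto simp: emeasure_eq_measure)
    then show ?thesis
    proof eventually_elim
      case (elim x)
      then obtain n0 where n0: "\<And>n. n0 \<le> n \<Longrightarrow> x \<notin> E n"
        by (auto simp: eventually_sequentially)
      have "i \<in> int_decode ` {..<n0}" if "Q x i j" for i
        using n0[of "int_encode i"] that by (force simp: E_def intro!: image_eqI[of _ _ "int_encode i"])
      then have "{i. Q x i j} \<subseteq> int_decode ` {..<n0}" by auto
      then show ?case by (rule finite_subset) simp
    qed
  qed
  then show ?thesis by (simp add: AE_all_countable)
qed

lemma AE_finite_fibres_record_map: "AE x in N. finite_fibres x"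
proof -
  have "AE x in N. \<forall>j. finite {i. record_map x i = j}"
  proof (rule AE_finite_fibres)
    show "Measurable.pred path_space (\<lambda>x. record_map x i = j)" for i j by measurable
  qed (auto simp: record_map_shift_by)
  moreover have "AE x in N. \<forall>j. finite {i. foil_root x i j}"
  proof (rule AE_finite_fibres)
    show "j = j'" if "foil_root x i j" "foil_root x i j'" for x i j j'
      using that unfolding foil_root_def by (meson order_antisym)
  qed (auto simp: foil_root_shift_by)
  ultimately show ?thesis by eventually_elim (simp add: finite_fibres_def)
qed

lemma prob_pos_if_not_AE:
  assumes "Measurable.pred path_space P" "\<not> (AE x in N. \<not> P x)"
  shows "0 < prob {x. P x}"
proof (rule ccontr)
  assume "\<not> 0 < prob {x. P x}"
  then have "prob {x. P x} = 0" using measure_nonneg[of N "{x. P x}"] by linarith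
  then have "AE x in N. x \<notin> {x. P x}"
    using prob_eq_0[OF pred_imp_sets[OF assms(1)]] by simp
  then show False using assms(2) by simp
qed

lemma prob_fixed_pos:
  assumes "mean < 0"
  shows "0 < prob {x. record_map x 0 = 0}"
proof (rule prob_pos_if_not_AE)
  show "\<not> (AE x in N. record_map x 0 \<noteq> 0)"
  proof
    assume "AE x in N. record_map x 0 \<noteq> 0"
    then have "AE x in N. \<exists>j>0. 0 \<le> (\<Sum>l<j. real_of_int (((shift_by 1 ^^ l) x) 0))"
    proof eventually_elim
      case (elim x)
      then obtain k where "0 < k" "0 \<le> walk x 0 k"
        by (auto simp: record_map_fixed_iff not_less)
      then have "0 \<le> (\<Sum>l<nat k. real_of_int (x (int l)))"
        using walk_nat_right[of x "nat k"] by (simp flip: of_int_sum)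
      then show ?case
        using \<open>0 < k\<close>
        by (intro exI[of _ "nat k"]) (simp add: funpow_shift_by shift_by_apply)
    qed
    then have "0 \<le> mean"
      by (rule maximal_ergodic[OF measurable_shift_by_law distr_shift_by integrable_coord_0])
    then show False using assms by simp
  qed
qed measurable

lemma prob_spine_pos:
  assumes "0 < mean"
  shows "0 < prob {x. spine_point x 0}"
proof (rule prob_pos_if_not_AE)
  let ?g = "\<lambda>x. - real_of_int (x (- 1))"
  show "\<not> (AE x in N. \<not> spine_point x 0)"
  proof
    assume "AE x in N. \<not> spine_point x 0"
    then have "AE x in N. \<exists>j>0. 0 \<le> (\<Sum>l<j. ?g ((shift_by (- 1) ^^ l) x))"
    proof eventually_elim
      case (elim x)
      then obtain k where "k < 0" "walk x k 0 \<le> 0"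
        by (auto simp: spine_point_def not_less)
      then have "(\<Sum>l<nat (- k). real_of_int (x (- 1 - int l))) \<le> 0"
        using walk_nat_left[of x "nat (- k)"] by (simp flip: of_int_sum)
      then show ?case
        using \<open>k < 0\<close>
        by (intro exI[of _ "nat (- k)"]) (simp add: funpow_shift_by shift_by_apply sum_negf)
    qed
    then have "0 \<le> (\<integral>x. ?g x \<partial>N)"
      using integral_coord(1)[of "- 1"]
      by (intro maximal_ergodic[OF measurable_shift_by_law distr_shift_by]) auto
    then show False using assms integral_coord(2)[of "- 1"] by simp
  qed
qed measurable

text \<open>
  If \<open>0\<close> had no record with probability \<open>p > 0\<close>, raise every step taken at such a point by one.
  From the last such point before \<open>0\<close>, which lies strictly above all later values of the walk, the
  raised walk still does not go up until \<open>0\<close>, so the maximal ergodic theorem for the reversed shift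
  gives \<open>mean + p \<le> 0\<close>.
\<close>

lemma AE_not_fixed:
  assumes "0 \<le> mean"
  shows "AE x in N. record_map x 0 \<noteq> 0"
proof (rule ccontr)
  assume "\<not> (AE x in N. record_map x 0 \<noteq> 0)"
  then have pos: "0 < prob {x. record_map x 0 = 0}"
    by (intro prob_pos_if_not_AE) simp_all
  define d where "d x = (if record_map x (- 1) = - 1 then 1 else 0 :: real)" for x
  have [measurable]: "d \<in> borel_measurable path_space" unfolding d_def by measurable
  have d: "integrable N d"
    by (rule integrable_const_bound[of _ 1]) (auto simp: d_def)
  have "d = (\<lambda>x. indicator {x. record_map (shift_by (- 1) x) 0 = 0} x)"
    by (auto simp: d_def record_map_shift_by indicator_def)
  then have "(\<integral>x. d x \<partial>N) = prob {x. record_map (shift_by (- 1) x) 0 = 0}"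
    by simp
  also have "\<dots> = prob {x. record_map x 0 = 0}"
    by (rule prob_shift_by) measurable
  finally have int_d: "(\<integral>x. d x \<partial>N) = prob {x. record_map x 0 = 0}" .
  let ?g = "\<lambda>x. - (real_of_int (x (- 1)) + d x)"
  have "AE x in N. \<forall>m. \<exists>k\<le>m. record_map (shift_by k x) 0 = 0"
    using pos by (intro AE_recurrence_below) measurable
  then have "AE x in N. \<exists>j>0. 0 \<le> (\<Sum>l<j. ?g ((shift_by (- 1) ^^ l) x))"
  proof eventually_elim
    case (elim x)
    obtain k where k: "k \<le> - 1" "record_map x k = k"
      using elim by (auto simp: record_map_shift_by)
    have "record_map x (- 1 - int (nat (- 1 - k))) = - 1 - int (nat (- 1 - k))"
      using k by simp
    define n where "n = (LEAST n. record_map x (- 1 - int n) = - 1 - int n)"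
    have n: "record_map x (- 1 - int n) = - 1 - int n"
      unfolding n_def by (rule LeastI) fact
    have least: "record_map x (- 1 - int l) \<noteq> - 1 - int l" if "l < n" for l
      using not_less_Least[OF that[unfolded n_def]] .
    have "d (shift_by (- int l) x) = 0" if "l < n" for l
      using least[OF that] by (auto simp: d_def record_map_shift_by)
    moreover have "d (shift_by (- int n) x) = 1"
      using n by (simp add: d_def record_map_shift_by)
    ultimately have "(\<Sum>l<Suc n. d (shift_by (- int l) x)) = 1" by simp
    moreover have "(\<Sum>l<Suc n. real_of_int (x (- 1 - int l))) \<le> - 1"
    proof -
      have "walk x (- 1 - int n) 0 < 0"
        using n unfolding record_map_fixed_iff by simp
      then have "real_of_int (walk x (- int (Suc n)) 0) \<le> - 1" by simp
      then show ?thesis unfolding walk_nat_left of_int_sum .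
    qed
    ultimately have "0 \<le> (\<Sum>l<Suc n. ?g ((shift_by (- 1) ^^ l) x))"
      by (simp add: funpow_shift_by shift_by_apply sum_negf sum_subtractf)
    then show ?case by blast
  qed
  then have "0 \<le> (\<integral>x. ?g x \<partial>N)"
    using integral_coord(1)[of "- 1"] d
    by (intro maximal_ergodic[OF measurable_shift_by_law distr_shift_by]) auto
  then show False
    using assms pos int_d d integral_coord[of "- 1"] by simp
qed

lemma AE_total_record:
  assumes "0 \<le> mean"
  shows "AE x in N. total_record x"
  using AE_shift_by[OF AE_not_fixed[OF assms]]
proof eventually_elim
  case (elim x)
  then have "record_map x k \<noteq> k" for k
    by (auto simp: record_map_shift_by)
  then show ?case
    using record_map_ge unfolding total_record_def by (metis order_le_neq_trans)
qed

lemma AE_class_FF: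
  assumes "mean < 0"
  shows "AE x in N. \<forall>C\<in>components_of_graph (record_graph x). class_FF x C"
proof -
  have "Measurable.pred path_space (\<lambda>x. record_map x 0 = 0)" by measurable
  note recurrence = AE_recurrence_below[OF this prob_fixed_pos[OF assms]]
    AE_recurrence_above[OF this prob_fixed_pos[OF assms]]
  show ?thesis
    using recurrence
    by eventually_elim (auto simp: record_map_shift_by intro!: fixed_unbounded_imp_class_FF)
qed

lemma AE_connected_class_IF:
  assumes "0 < mean"
  shows "AE x in N. Digraph_Component.connected (with_proj (record_graph x)) \<and> class_IF x UNIV"
proof -
  have "AE x in N. \<forall>m. \<exists>k\<le>m. spine_point (shift_by k x) 0"
    using prob_spine_pos[OF assms] by (intro AE_recurrence_below) measurable
  then show ?thesis
    using AE_total_record[OF less_imp_le[OF assms]] AE_finite_fibres_record_map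
    by eventually_elim
      (auto simp: spine_point_shift_by intro: total_record_connected spine_imp_class_IF)
qed

lemma AE_connected_class_cases:
  assumes "mean = 0"
  shows "AE x in N. Digraph_Component.connected (with_proj (record_graph x)) \<and>
    (class_IF x UNIV \<or> class_II x UNIV)"
proof -
  have "AE x in N. total_record x" by (rule AE_total_record) (simp add: assms)
  then show ?thesis
    using AE_finite_fibres_record_map
    by eventually_elim (intro conjI total_record_connected total_record_class_cases)
qed

end

theorem theorem119:
  fixes M :: "'a measure" and X :: "int \<Rightarrow> 'a \<Rightarrow> int"
  assumes "prob_space M"
    and "\<And>n. X n \<in> M \<rightarrow>\<^sub>M count_space UNIV"
    and "stationary_sequence M X"
    and "ergodic_sequence M X"
    and "integrable M (\<lambda>\<omega>. real_of_int (X 0 \<omega>))"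
  shows
    "((\<integral>\<omega>. real_of_int (X 0 \<omega>) \<partial>M) < 0 \<longrightarrow>
        (AE \<omega> in M. \<forall>C \<in> components_of_graph (record_graph (\<lambda>n. X n \<omega>)).
           class_FF (\<lambda>n. X n \<omega>) C))
   \<and> ((\<integral>\<omega>. real_of_int (X 0 \<omega>) \<partial>M) > 0 \<longrightarrow>
        (AE \<omega> in M. Digraph_Component.connected (with_proj (record_graph (\<lambda>n. X n \<omega>))) \<and>
           class_IF (\<lambda>n. X n \<omega>) (pverts (record_graph (\<lambda>n. X n \<omega>)))))
   \<and> ((\<integral>\<omega>. real_of_int (X 0 \<omega>) \<partial>M) = 0 \<longrightarrow>
        (AE \<omega> in M. Digraph_Component.connected (with_proj (record_graph (\<lambda>n. X n \<omega>))) \<and>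
           (class_IF (\<lambda>n. X n \<omega>) (pverts (record_graph (\<lambda>n. X n \<omega>))) \<or>
            class_II (\<lambda>n. X n \<omega>) (pverts (record_graph (\<lambda>n. X n \<omega>))))))"
proof -
  interpret M: prob_space M by fact
  let ?path = "\<lambda>\<omega> n. X n \<omega>"
  define N where "N = distr M path_space ?path"
  have path: "?path \<in> M \<rightarrow>\<^sub>M path_space"
    using assms(2) by (intro measurable_PiM_single') (auto simp: space_PiM)
  interpret ergodic_law N
  proof (intro ergodic_law.intro ergodic_law_axioms.intro)
    show "prob_space N" unfolding N_def by (rule M.prob_space_distr[OF path])
    show sets: "sets N = sets path_space" by (simp add: N_def)
    show "distr N N (shift_by k) = N" for k
    proof -
      have "distr N N (shift_by k) = distr N path_space (shift_by k)"
        by (rule distr_cong) (simp_all add: sets)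
      also have "\<dots> = distr M path_space (shift_by k \<circ> ?path)"
        unfolding N_def by (rule distr_distr[OF measurable_shift_by path])
      also have "\<dots> = distr M path_space (\<lambda>\<omega> n. X (n + k) \<omega>)"
        by (simp add: shift_by_def comp_def)
      also have "\<dots> = N"
        using assms(3) by (simp add: stationary_sequence_def N_def)
      finally show ?thesis .
    qed
    show "measure N A \<in> {0, 1}" if "A \<in> sets path_space" "shift -` A = A" for A
      using assms(4) that unfolding ergodic_sequence_def N_def by blast
    show "integrable N (\<lambda>x. real_of_int (x 0))"
      unfolding N_def using assms(5) by (subst integrable_distr_eq[OF path]) simp_all
  qed
  have mean: "mean = (\<integral>\<omega>. real_of_int (X 0 \<omega>) \<partial>M)"
    unfolding N_def by (rule integral_distr[OF path]) measurable
  have transfer: "AE \<omega> in M. P (?path \<omega>)" if "AE x in N. P x" for P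
    using AE_distrD[OF path] that unfolding N_def .
  show ?thesis
    unfolding pverts_record_graph mean[symmetric]
    using transfer[OF AE_class_FF] transfer[OF AE_connected_class_IF]
      transfer[OF AE_connected_class_cases] by blast
qed

end
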